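(* For $n\geq 2$, let $\mathrm{Dic}_n=\langle a,x \mid a^{2n}=e,\ x^2=a^n,\ x^{-1}ax=a^{-1}\rangle$ be the dicyclic group of order $4n$. Then Player 1 has a winning strategy for $\texttt{RAV}(\mathrm{Dic}_n,\{a,x\})$.
   Context: Every element of $\mathrm{Dic}_n$ has a unique normal form $a^ix^j$ with $0\le i<2n$ and $j\in\{0,1\}$. Game $\texttt{RAV}(G,S)$: $G$ is a finite group and $S$ a generating set with $e\notin S$. Two players alternate turns, Player 1 first, starting from the empty word $w_0$. On turn $n$ the current player chooses $s_n\in S\cup S^{-1}$, subject to $s_n\neq s_{n-1}^{-1}$ when $n>1$, and forms $w_n=w_{n-1}s_n$. If $w_n$ represents the same element of $G$ as some $w_k$ with $0\le k<n$, the player who formed $w_n$ loses. If a player has no legal move, that player loses. *)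

theory Defs
  imports "HOL-Algebra.Algebra"
begin

section \<open>Groups given by generators and relations\<close>

text \<open>
  A word over a type of generators: \<open>(g, True)\<close> stands for \<open>g\<close> and \<open>(g, False)\<close> for \<open>g\<inverse>\<close>.
  A pair \<open>(l, r)\<close> in a set of relations stands for the relation \<open>l = r\<close>.
\<close>

type_synonym 'g gword = "('g \<times> bool) list"

inductive pres_eq :: "('g gword \<times> 'g gword) set \<Rightarrow> 'g gword \<Rightarrow> 'g gword \<Rightarrow> bool"
  for R where
  refl: "pres_eq R u u"
| sym: "pres_eq R u v \<Longrightarrow> pres_eq R v u"
| trans: "pres_eq R u v \<Longrightarrow> pres_eq R v w \<Longrightarrow> pres_eq R u w"
| cancel: "pres_eq R (u @ [(g, b), (g, \<not> b)] @ v) (u @ v)"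
| rel: "(l, r) \<in> R \<Longrightarrow> pres_eq R (u @ l @ v) (u @ r @ v)"

definition pres_class :: "('g gword \<times> 'g gword) set \<Rightarrow> 'g gword \<Rightarrow> 'g gword set" where
  "pres_class R u = {v. pres_eq R u v}"

definition presented_group :: "('g gword \<times> 'g gword) set \<Rightarrow> 'g gword set monoid" where
  "presented_group R =
    \<lparr>carrier = range (pres_class R),
     monoid.mult = (\<lambda>A B. {w. \<exists>u\<in>A. \<exists>v\<in>B. pres_eq R (u @ v) w}),
     one = pres_class R []\<rparr>"

section \<open>The dicyclic group\<close>

datatype dic_gen = GenA | GenX

definition dic_rels :: "nat \<Rightarrow> (dic_gen gword \<times> dic_gen gword) set" where
  "dic_rels n =
    {(replicate (2 * n) (GenA, True), []),
     ([(GenX, True), (GenX, True)], replicate n (GenA, True)),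
     ([(GenX, False), (GenA, True), (GenX, True)], [(GenA, False)])}"

definition Dic :: "nat \<Rightarrow> dic_gen gword set monoid" where
  "Dic n = presented_group (dic_rels n)"

definition dic_a :: "nat \<Rightarrow> dic_gen gword set" where
  "dic_a n = pres_class (dic_rels n) [(GenA, True)]"

definition dic_x :: "nat \<Rightarrow> dic_gen gword set" where
  "dic_x n = pres_class (dic_rels n) [(GenX, True)]"

section \<open>The game RAV\<close>

text \<open>
  A position is the list \<open>[s\<^sub>1, \<dots>, s\<^sub>n]\<close> of group elements chosen so far, in order of play.
\<close>

definition rav_instance :: "('a, 'b) monoid_scheme \<Rightarrow> 'a set \<Rightarrow> bool" where
  "rav_instance G S \<longleftrightarrow> group G \<and> finite (carrier G) \<and> S \<subseteq> carrier G \<and>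
     generate G S = carrier G \<and> \<one>\<^bsub>G\<^esub> \<notin> S"

definition word_value :: "('a, 'b) monoid_scheme \<Rightarrow> 'a list \<Rightarrow> 'a" where
  "word_value G w = foldl (\<lambda>g s. g \<otimes>\<^bsub>G\<^esub> s) \<one>\<^bsub>G\<^esub> w"

definition legal_move :: "('a, 'b) monoid_scheme \<Rightarrow> 'a set \<Rightarrow> 'a list \<Rightarrow> 'a \<Rightarrow> bool" where
  "legal_move G S w s \<longleftrightarrow> s \<in> S \<union> m_inv G ` S \<and> (w \<noteq> [] \<longrightarrow> s \<noteq> inv\<^bsub>G\<^esub> (last w))"

definition revisits :: "('a, 'b) monoid_scheme \<Rightarrow> 'a list \<Rightarrow> bool" where
  "revisits G w \<longleftrightarrow> (\<exists>k < length w. word_value G w = word_value G (take k w))"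

definition game_over :: "('a, 'b) monoid_scheme \<Rightarrow> 'a set \<Rightarrow> 'a list \<Rightarrow> bool" where
  "game_over G S w \<longleftrightarrow> revisits G w \<or> (\<nexists>s. legal_move G S w s)"

inductive rav_position :: "('a, 'b) monoid_scheme \<Rightarrow> 'a set \<Rightarrow> 'a list \<Rightarrow> bool"
  for G S where
  start: "rav_position G S []"
| move: "rav_position G S w \<Longrightarrow> \<not> game_over G S w \<Longrightarrow> legal_move G S w s \<Longrightarrow>
    rav_position G S (w @ [s])"

datatype player = Player1 | Player2

fun opponent :: "player \<Rightarrow> player" where
  "opponent Player1 = Player2"
| "opponent Player2 = Player1"

definition to_move :: "'a list \<Rightarrow> player" where
  "to_move w = (if even (length w) then Player1 else Player2)"

text \<open>Meaningful only if the game is over at \<open>w\<close>; the last move was made by the opponent of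
  the player to move.\<close>

definition loser :: "('a, 'b) monoid_scheme \<Rightarrow> 'a list \<Rightarrow> player" where
  "loser G w = (if revisits G w then opponent (to_move w) else to_move w)"

text \<open>A strategy maps the history of the play to the next move.\<close>

definition follows :: "player \<Rightarrow> ('a list \<Rightarrow> 'a) \<Rightarrow> 'a list \<Rightarrow> bool" where
  "follows p \<sigma> w \<longleftrightarrow> (\<forall>i < length w. to_move (take i w) = p \<longrightarrow> w ! i = \<sigma> (take i w))"

text \<open>
  Every play of an instance of the game ends after at most \<open>|G|\<close> moves (see
  \<open>rav_position_length\<close> below), so that infinite plays need not be considered.
  The game is defined for such instances only, hence the first conjunct of
  \<open>has_winning_strategy\<close>; it holds for the dicyclic groups by \<open>rav_instance_Dic\<close>.
\<close>

definition winning_strategy ::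
    "('a, 'b) monoid_scheme \<Rightarrow> 'a set \<Rightarrow> player \<Rightarrow> ('a list \<Rightarrow> 'a) \<Rightarrow> bool" where
  "winning_strategy G S p \<sigma> \<longleftrightarrow>
    (\<forall>w. rav_position G S w \<and> follows p \<sigma> w \<longrightarrow>
      (if game_over G S w then loser G w \<noteq> p
       else to_move w = p \<longrightarrow> legal_move G S w (\<sigma> w)))"

definition has_winning_strategy :: "('a, 'b) monoid_scheme \<Rightarrow> 'a set \<Rightarrow> player \<Rightarrow> bool" where
  "has_winning_strategy G S p \<longleftrightarrow> rav_instance G S \<and> (\<exists>\<sigma>. winning_strategy G S p \<sigma>)"

section \<open>Plays are finite\<close>

lemma word_value_snoc: "word_value G (w @ [s]) = word_value G w \<otimes>\<^bsub>G\<^esub> s"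
  by (simp add: word_value_def)

lemma word_value_closed:
  assumes "rav_instance G S" "rav_position G S w"
  shows "word_value G w \<in> carrier G"
  using assms(2)
proof induction
  case start
  interpret group G using assms(1) by (simp add: rav_instance_def)
  show ?case by (simp add: word_value_def)
next
  case (move w s)
  interpret group G using assms(1) by (simp add: rav_instance_def)
  have "s \<in> carrier G"
    using move assms(1) by (auto simp: legal_move_def rav_instance_def)
  then show ?case using move by (simp add: word_value_snoc)
qed

lemma rav_position_take:
  "rav_position G S w \<Longrightarrow> rav_position G S (take k w)"
proof (induction rule: rav_position.induct)
  case start
  then show ?case by (simp add: rav_position.start)
next
  case (move w s)
  then show ?case
    by (cases "k \<le> length w") (auto intro: rav_position.move)
qed

lemma rav_position_not_revisits:
  "rav_position G S w \<Longrightarrow> k < length w \<Longrightarrow> \<not> revisits G (take k w)"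
proof (induction rule: rav_position.induct)
  case start
  then show ?case by simp
next
  case (move w s)
  then show ?case
    by (cases "k = length w") (auto simp: game_over_def)
qed

lemma rav_position_length:
  assumes G: "rav_instance G S" and w: "rav_position G S w"
  shows "length w \<le> card (carrier G)"
proof -
  have inj: "inj_on (\<lambda>k. word_value G (take k w)) {..<length w}"
  proof (rule linorder_inj_onI')
    fix i j assume ij: "i \<in> {..<length w}" "j \<in> {..<length w}" "i < j"
    then have "\<not> revisits G (take j w)" using rav_position_not_revisits[OF w] by simp
    then show "word_value G (take i w) \<noteq> word_value G (take j w)"
      using ij by (auto simp: revisits_def min_def dest!: spec[of _ i])
  qed
  have "(\<lambda>k. word_value G (take k w)) ` {..<length w} \<subseteq> carrier G"
    using word_value_closed[OF G rav_position_take[OF w]] by auto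
  then have "card {..<length w} \<le> card (carrier G)"
    using card_inj_on_le[OF inj] G by (auto simp: rav_instance_def)
  then show ?thesis by simp
qed

section \<open>The presented group is a group\<close>

lemma pres_eq_context: "pres_eq R u v \<Longrightarrow> pres_eq R (p @ u @ q) (p @ v @ q)"
proof (induction rule: pres_eq.induct)
  case (cancel u g b v)
  show ?case using pres_eq.cancel[of R "p @ u" g b "v @ q"] by simp
next
  case (rel l r u v)
  then show ?case using pres_eq.rel[of l r R "p @ u" "v @ q"] by simp
qed (auto intro: pres_eq.intros)

lemma pres_eq_append: "pres_eq R u u' \<Longrightarrow> pres_eq R v v' \<Longrightarrow> pres_eq R (u @ v) (u' @ v')"
  using pres_eq_context[of R u u' "[]" v] pres_eq_context[of R v v' u' "[]"]
  by (auto intro: pres_eq.trans)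

lemma pres_class_eq_iff: "pres_class R u = pres_class R v \<longleftrightarrow> pres_eq R u v"
  by (auto simp: pres_class_def set_eq_iff intro: pres_eq.intros)

lemma presented_mult:
  "pres_class R u \<otimes>\<^bsub>presented_group R\<^esub> pres_class R v = pres_class R (u @ v)"
  by (auto simp: presented_group_def pres_class_def
      intro: pres_eq.refl pres_eq.trans pres_eq_append)

lemma presented_one: "\<one>\<^bsub>presented_group R\<^esub> = pres_class R []"
  by (simp add: presented_group_def)

lemma presented_carrier: "carrier (presented_group R) = range (pres_class R)"
  by (simp add: presented_group_def)

lemma presented_left_inverse: "\<exists>v. pres_eq R (v @ u) []"
proof (induction u)
  case Nil
  show ?case by (auto intro: exI[of _ "[]"] pres_eq.refl)
next
  case (Cons s u)
  then obtain v where v: "pres_eq R (v @ u) []" by blast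
  obtain g b where s: "s = (g, b)" by (cases s)
  have "pres_eq R (v @ [(g, \<not> b), (g, \<not> \<not> b)] @ u) (v @ u)" by (rule pres_eq.cancel)
  then have "pres_eq R ((v @ [(g, \<not> b)]) @ s # u) []"
    using v by (auto simp: s intro: pres_eq.trans)
  then show ?case by blast
qed

lemma group_presented: "group (presented_group R)"
proof (rule groupI)
  fix x assume "x \<in> carrier (presented_group R)"
  then obtain u where u: "x = pres_class R u" by (auto simp: presented_carrier)
  obtain v where "pres_eq R (v @ u) []" using presented_left_inverse by blast
  then show "\<exists>y\<in>carrier (presented_group R). y \<otimes>\<^bsub>presented_group R\<^esub> x = \<one>\<^bsub>presented_group R\<^esub>"
    by (auto simp: u presented_carrier presented_mult presented_one pres_class_eq_iff)
qed (auto simp: presented_carrier presented_mult presented_one)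

lemma presented_inv_gen:
  "inv\<^bsub>presented_group R\<^esub> (pres_class R [(g, b)]) = pres_class R [(g, \<not> b)]"
proof -
  interpret group "presented_group R" by (rule group_presented)
  have "pres_eq R ([] @ [(g, \<not> b), (g, \<not> \<not> b)] @ []) ([] @ [])" by (rule pres_eq.cancel)
  then show ?thesis
    by (intro inv_equality)
      (auto simp: presented_mult presented_one presented_carrier pres_class_eq_iff)
qed

lemma presented_generate:
  "generate (presented_group R) (range (\<lambda>g. pres_class R [(g, True)])) = carrier (presented_group R)"
  (is "generate ?G ?S = _")
proof -
  interpret group ?G by (rule group_presented)
  have "pres_class R u \<in> generate ?G ?S" for u
  proof (induction u)
    case Nil
    show ?case using generate.one[of ?G ?S] by (simp add: presented_one)
  next
    case (Cons s u)
    obtain g b where s: "s = (g, b)" by (cases s)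
    have "pres_class R [(g, b)] \<in> generate ?G ?S"
    proof (cases b)
      case True
      then show ?thesis by (auto intro: generate.incl)
    next
      case False
      have "inv\<^bsub>?G\<^esub> (pres_class R [(g, True)]) \<in> generate ?G ?S" by (auto intro: generate.inv)
      then show ?thesis using False by (simp add: presented_inv_gen)
    qed
    from generate.eng[OF this Cons] show ?case by (simp add: s presented_mult)
  qed
  moreover have "generate ?G ?S \<subseteq> carrier ?G"
    by (rule generate_incl) (auto simp: presented_carrier)
  ultimately show ?thesis by (auto simp: presented_carrier)
qed

section \<open>Normal forms in the dicyclic group\<close>

text \<open>
  The pair \<open>(i, j)\<close> with \<open>0 \<le> i < 2n\<close> represents \<open>a\<^sup>i\<close> if \<open>\<not> j\<close> and \<open>a\<^sup>i x\<close> if \<open>j\<close>; words act on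
  these pairs from the right.
\<close>

fun dic_step :: "nat \<Rightarrow> int \<times> bool \<Rightarrow> dic_gen \<times> bool \<Rightarrow> int \<times> bool" where
  "dic_step n (i, j) (GenA, b) = ((if b = j then i - 1 else i + 1) mod (2 * int n), j)"
| "dic_step n (i, j) (GenX, b) = ((if b = j then i + int n else i) mod (2 * int n), \<not> j)"

definition dic_states :: "nat \<Rightarrow> (int \<times> bool) set" where
  "dic_states n = {0..<2 * int n} \<times> UNIV"

lemma dic_step_states: "n > 0 \<Longrightarrow> dic_step n s g \<in> dic_states n"
  by (cases "(n, s, g)" rule: dic_step.cases) (auto simp: dic_states_def)

lemma dic_run_states: "n > 0 \<Longrightarrow> s \<in> dic_states n \<Longrightarrow> foldl (dic_step n) s w \<in> dic_states n"
  by (induction w arbitrary: s) (auto simp: dic_step_states)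

lemma dic_step_cancel:
  assumes "n > 0" "s \<in> dic_states n"
  shows "dic_step n (dic_step n s (g, b)) (g, \<not> b) = s"
proof -
  have m: "(i + int n + int n) mod (2 * int n) = i mod (2 * int n)" for i :: int
    by (metis add.assoc mod_add_self2 mult_2)
  obtain i j where s: "s = (i, j)" "0 \<le> i" "i < 2 * int n"
    using assms(2) by (auto simp: dic_states_def)
  show ?thesis
    using m[of i] s by (cases g; cases b; cases j) (simp_all add: mod_simps)
qed

lemma dic_run_A:
  assumes "n > 0" "(i, j) \<in> dic_states n"
  shows "foldl (dic_step n) (i, j) (replicate k (GenA, True)) =
    ((if j then i - int k else i + int k) mod (2 * int n), j)"
  using assms(2)
proof (induction k arbitrary: i)
  case 0
  then show ?case by (auto simp: dic_states_def)
next
  case (Suc k)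
  have "dic_step n (i, j) (GenA, True) \<in> dic_states n" using assms(1) by (rule dic_step_states)
  with Suc.IH[of "fst (dic_step n (i, j) (GenA, True))"] show ?case
    by (cases j) (auto simp: mod_simps algebra_simps)
qed

lemma dic_run_rel:
  assumes n: "n > 0" and s: "s \<in> dic_states n" and "(l, r) \<in> dic_rels n"
  shows "foldl (dic_step n) s l = foldl (dic_step n) s r"
proof -
  obtain i j where ij: "s = (i, j)" "0 \<le> i" "i < 2 * int n"
    using s by (auto simp: dic_states_def)
  have m: "(i - 2 * int n) mod (2 * int n) = i" "(i + 2 * int n) mod (2 * int n) = i"
    "(i - int n) mod (2 * int n) = (i + int n) mod (2 * int n)"
    using ij by (auto simp: mod_eq_dvd_iff)
  have q: "(i + int n + int n + k) mod (2 * int n) = (i + k) mod (2 * int n)" for k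
    by (auto simp: mod_eq_dvd_iff)
  have q': "(i + int n + k + int n) mod (2 * int n) = (i + k) mod (2 * int n)" for k
    by (auto simp: mod_eq_dvd_iff)
  show ?thesis
    using assms(3) dic_run_A[OF n s[unfolded ij(1)], of "2 * n"]
      dic_run_A[OF n s[unfolded ij(1)], of n] m q'[of 1] q'[of "-1"]
    by (cases j) (auto simp: dic_rels_def ij mod_simps)
qed

lemma dic_run_cong:
  assumes n: "n > 0"
  shows "pres_eq (dic_rels n) u v \<Longrightarrow> s \<in> dic_states n \<Longrightarrow>
    foldl (dic_step n) s u = foldl (dic_step n) s v"
proof (induction arbitrary: s rule: pres_eq.induct)
  case (cancel u g b v)
  then show ?case using dic_step_cancel[OF n dic_run_states[OF n]] by simp
next
  case (rel l r u v)
  then show ?case using dic_run_rel[OF n dic_run_states[OF n]] by simp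
qed auto

lemma group_Dic: "group (Dic n)"
  by (simp add: Dic_def group_presented)

lemma dic_ax_closed [simp]: "dic_a n \<in> carrier (Dic n)" "dic_x n \<in> carrier (Dic n)"
  by (simp_all add: Dic_def dic_a_def dic_x_def presented_carrier)

lemma pres_class_replicate:
  "pres_class R [(g, True)] [^]\<^bsub>presented_group R\<^esub> (k::nat) = pres_class R (replicate k (g, True))"
  by (induction k)
    (auto simp: presented_one presented_mult nat_pow_def replicate_append_same)

lemma dic_relations:
  "dic_a n [^]\<^bsub>Dic n\<^esub> (2 * n) = \<one>\<^bsub>Dic n\<^esub>"
  "dic_x n [^]\<^bsub>Dic n\<^esub> (2::nat) = dic_a n [^]\<^bsub>Dic n\<^esub> n"
  "inv\<^bsub>Dic n\<^esub> (dic_x n) \<otimes>\<^bsub>Dic n\<^esub> dic_a n \<otimes>\<^bsub>Dic n\<^esub> dic_x n = inv\<^bsub>Dic n\<^esub> (dic_a n)"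
  using pres_eq.rel[of _ _ "dic_rels n" "[]" "[]"]
  by (simp_all add: Dic_def dic_a_def dic_x_def pres_class_replicate presented_one
      presented_mult presented_inv_gen pres_class_eq_iff dic_rels_def numeral_2_eq_2)

lemma dic_run_normal_form:
  assumes n: "n > 0" and i: "i < 2 * n"
  shows "foldl (dic_step n) (0, False) (replicate i (GenA, True) @ replicate (of_bool j) (GenX, True))
    = (int i, j)"
  using dic_run_A[of n 0 False i] assms by (cases j) (auto simp: dic_states_def)


definition dic_elt :: "nat \<Rightarrow> int \<times> bool \<Rightarrow> dic_gen gword set" where
  "dic_elt n s = dic_a n [^]\<^bsub>Dic n\<^esub> fst s \<otimes>\<^bsub>Dic n\<^esub> dic_x n [^]\<^bsub>Dic n\<^esub> (of_bool (snd s) :: nat)"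

lemma dic_elt_step:
  assumes n: "n > 0"
  shows "dic_elt n s \<otimes>\<^bsub>Dic n\<^esub> pres_class (dic_rels n) [g] = dic_elt n (dic_step n s g)"
proof -
  interpret group "Dic n" by (rule group_Dic)
  note [simp] = int_pow_closed
  have a2n: "dic_a n [^]\<^bsub>Dic n\<^esub> (2 * int n) = \<one>\<^bsub>Dic n\<^esub>"
    using dic_relations(1)[of n] by (metis int_pow_int of_nat_mult of_nat_numeral)
  have a_mod: "dic_a n [^]\<^bsub>Dic n\<^esub> (i mod (2 * int n)) = dic_a n [^]\<^bsub>Dic n\<^esub> i" for i :: int
  proof -
    have "dic_a n [^]\<^bsub>Dic n\<^esub> i =
        dic_a n [^]\<^bsub>Dic n\<^esub> ((2 * int n) * (i div (2 * int n)) + i mod (2 * int n))"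
      by simp
    also have "\<dots> = (dic_a n [^]\<^bsub>Dic n\<^esub> (2 * int n)) [^]\<^bsub>Dic n\<^esub> (i div (2 * int n)) \<otimes>\<^bsub>Dic n\<^esub>
        dic_a n [^]\<^bsub>Dic n\<^esub> (i mod (2 * int n))"
      by (subst int_pow_mult) (simp_all add: int_pow_pow)
    finally show ?thesis by (simp add: a2n)
  qed
  have xx: "dic_x n \<otimes>\<^bsub>Dic n\<^esub> dic_x n = dic_a n [^]\<^bsub>Dic n\<^esub> int n"
    using dic_relations(2)[of n] by (simp add: int_pow_int numeral_2_eq_2)
  have xia: "dic_x n \<otimes>\<^bsub>Dic n\<^esub> inv\<^bsub>Dic n\<^esub> dic_a n = dic_a n \<otimes>\<^bsub>Dic n\<^esub> dic_x n"
    using dic_relations(3)[of n] by (simp add: m_assoc inv_solve_left')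
  have xa: "dic_x n \<otimes>\<^bsub>Dic n\<^esub> dic_a n = inv\<^bsub>Dic n\<^esub> dic_a n \<otimes>\<^bsub>Dic n\<^esub> dic_x n"
    by (metis xia dic_ax_closed inv_closed inv_solve_left inv_solve_right m_assoc m_closed)
  have ix: "inv\<^bsub>Dic n\<^esub> dic_x n = dic_a n [^]\<^bsub>Dic n\<^esub> int n \<otimes>\<^bsub>Dic n\<^esub> dic_x n"
  proof (rule inv_equality)
    have "dic_a n [^]\<^bsub>Dic n\<^esub> int n \<otimes>\<^bsub>Dic n\<^esub> dic_x n \<otimes>\<^bsub>Dic n\<^esub> dic_x n = dic_a n [^]\<^bsub>Dic n\<^esub> (2 * int n)"
      by (simp add: m_assoc xx flip: int_pow_mult)
    then show "dic_a n [^]\<^bsub>Dic n\<^esub> int n \<otimes>\<^bsub>Dic n\<^esub> dic_x n \<otimes>\<^bsub>Dic n\<^esub> dic_x n = \<one>\<^bsub>Dic n\<^esub>"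
      by (simp add: a2n)
  qed simp_all
  have up: "dic_a n [^]\<^bsub>Dic n\<^esub> i \<otimes>\<^bsub>Dic n\<^esub> dic_a n = dic_a n [^]\<^bsub>Dic n\<^esub> (i + 1)" for i :: int
    by (simp add: int_pow_mult)
  have down: "dic_a n [^]\<^bsub>Dic n\<^esub> i \<otimes>\<^bsub>Dic n\<^esub> inv\<^bsub>Dic n\<^esub> dic_a n = dic_a n [^]\<^bsub>Dic n\<^esub> (i - 1)" for i :: int
    by (simp add: int_pow_diff)
  have gens: "pres_class (dic_rels n) [(GenA, True)] = dic_a n"
    "pres_class (dic_rels n) [(GenX, True)] = dic_x n"
    "pres_class (dic_rels n) [(GenA, False)] = inv\<^bsub>Dic n\<^esub> dic_a n"
    "pres_class (dic_rels n) [(GenX, False)] = inv\<^bsub>Dic n\<^esub> dic_x n"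
    by (simp_all add: dic_a_def dic_x_def Dic_def presented_inv_gen)
  obtain i j h b where sg: "s = (i, j)" "g = (h, b)" by (cases s, cases g)
  show ?thesis
  proof (cases h)
    case GenA
    show ?thesis
    proof (cases j)
      case True
      then show ?thesis using GenA
        by (cases b)
          (simp_all add: sg dic_elt_def gens a_mod m_assoc xa xia,
           simp_all add: up down flip: m_assoc)
    next
      case False
      then show ?thesis using GenA
        by (cases b) (simp_all add: sg dic_elt_def gens a_mod up down)
    qed
  next
    case GenX
    show ?thesis
    proof (cases j)
      case True
      then show ?thesis using GenX
        by (cases b) (simp_all add: sg dic_elt_def gens a_mod m_assoc xx int_pow_mult)
    next
      case False
      then show ?thesis using GenX
        by (cases b)
          (simp_all add: sg dic_elt_def gens a_mod ix int_pow_mult m_assoc)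
    qed
  qed
qed

lemma dic_elt_run:
  assumes n: "n > 0"
  shows "pres_class (dic_rels n) w = dic_elt n (foldl (dic_step n) (0, False) w)"
proof (induction w rule: rev_induct)
  case Nil
  interpret group "Dic n" by (rule group_Dic)
  show ?case by (simp add: dic_elt_def) (simp add: Dic_def presented_one)
next
  case (snoc g w)
  have "pres_class (dic_rels n) (w @ [g]) =
      pres_class (dic_rels n) w \<otimes>\<^bsub>Dic n\<^esub> pres_class (dic_rels n) [g]"
    by (simp add: Dic_def presented_mult)
  with snoc show ?case by (simp add: dic_elt_step[OF n])
qed

theorem dic_normal_form:
  assumes n: "n > 0"
  shows "bij_betw (\<lambda>(i, j). dic_a n [^]\<^bsub>Dic n\<^esub> (i::nat) \<otimes>\<^bsub>Dic n\<^esub> dic_x n [^]\<^bsub>Dic n\<^esub> (j::nat))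
    ({0..<2 * n} \<times> {0, 1}) (carrier (Dic n))"
  (is "bij_betw ?f ?A _")
proof (intro bij_betw_imageI)
  interpret group "Dic n" by (rule group_Dic)
  let ?w = "\<lambda>i j. replicate i (GenA, True) @ replicate j (GenX, True)"
  have f: "?f (i, j) = pres_class (dic_rels n) (?w i j)" for i j
    by (simp add: Dic_def dic_a_def dic_x_def pres_class_replicate presented_mult)
  have run: "foldl (dic_step n) (0, False) (?w i j) = (int i, j = 1)" if "(i, j) \<in> ?A" for i j
    using dic_run_normal_form[OF n, of i "j = 1"] that by auto
  show "inj_on ?f ?A"
  proof (rule inj_onI)
    fix p q assume pq: "p \<in> ?A" "q \<in> ?A" "?f p = ?f q"
    obtain i j i' j' where ij: "p = (i, j)" "q = (i', j')" by (cases p, cases q)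
    from pq have *: "(i, j) \<in> ?A" "(i', j') \<in> ?A" "?f (i, j) = ?f (i', j')"
      unfolding ij .
    have "(0, False) \<in> dic_states n" using n by (simp add: dic_states_def)
    with * have "(int i, j = 1) = (int i', j' = 1)"
      unfolding f pres_class_eq_iff run[OF *(1), symmetric] run[OF *(2), symmetric]
      by (metis dic_run_cong[OF n])
    then show "p = q" using * ij by auto
  qed
  show "?f ` ?A = carrier (Dic n)"
  proof
    show "?f ` ?A \<subseteq> carrier (Dic n)" by auto
    show "carrier (Dic n) \<subseteq> ?f ` ?A"
    proof
      fix g assume "g \<in> carrier (Dic n)"
      then obtain w where w: "g = pres_class (dic_rels n) w"
        by (auto simp: Dic_def presented_carrier)
      obtain i j where ij: "foldl (dic_step n) (0, False) w = (i, j)" "0 \<le> i" "i < 2 * int n"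
        using dic_run_states[OF n, of "(0, False)" w] n by (auto simp: dic_states_def)
      have "g = ?f (nat i, of_bool j)"
        using ij by (simp add: w dic_elt_run[OF n] dic_elt_def flip: int_pow_int)
      moreover have "(nat i, of_bool j) \<in> ?A" using ij by auto
      ultimately show "g \<in> ?f ` ?A" by blast
    qed
  qed
qed

corollary order_Dic: "n > 0 \<Longrightarrow> order (Dic n) = 4 * n"
  using bij_betw_same_card[OF dic_normal_form[of n]] by (simp add: order_def card_cartesian_product)

lemma UNIV_dic_gen: "UNIV = {GenA, GenX}"
  using dic_gen.exhaust by auto

corollary rav_instance_Dic:
  assumes "n > 0"
  shows "rav_instance (Dic n) {dic_a n, dic_x n}"
proof -
  interpret group "Dic n" by (rule group_Dic)
  have "finite (carrier (Dic n))"
    using order_Dic[OF assms] assms by (intro card_ge_0_finite) (simp add: order_def)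
  moreover have "range (\<lambda>g. pres_class (dic_rels n) [(g, True)]) = {dic_a n, dic_x n}"
    by (simp add: UNIV_dic_gen dic_a_def dic_x_def)
  then have "generate (Dic n) {dic_a n, dic_x n} = carrier (Dic n)"
    using presented_generate[of "dic_rels n"] by (simp add: Dic_def)
  moreover have "pres_class (dic_rels n) [] \<noteq> pres_class (dic_rels n) [(g, True)]" for g
  proof
    assume "pres_class (dic_rels n) [] = pres_class (dic_rels n) [(g, True)]"
    then have "foldl (dic_step n) (0, False) [] = foldl (dic_step n) (0, False) [(g, True)]"
      using dic_run_cong[OF assms, of "[]" "[(g, True)]" "(0, False)"] assms
      by (simp add: pres_class_eq_iff dic_states_def)
    then show False using assms by (cases g) auto
  qed
  then have "\<one>\<^bsub>Dic n\<^esub> \<notin> {dic_a n, dic_x n}"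
    by (simp add: Dic_def presented_one dic_a_def dic_x_def)
  ultimately show ?thesis by (simp add: rav_instance_def group_Dic)
qed

end

theory Submission
  imports Defs
begin

text \<open>
  Right multiplication by \<open>x\<close> on \<open>\<langle>a\<rangle>\<close> and by \<open>x\<inverse>\<close> on \<open>\<langle>a\<rangle>x\<close> is a perfect matching of the
  Cayley graph. Player 1 always moves to the partner of the current element: before each of his
  moves, the elements visited earlier form complete pairs, so that the partner is still unvisited.
\<close>

text \<open>The matching is encoded by edge labels: \<open>f g\<close> is the letter leading from
  \<open>g\<close> to its partner, and the premise \<open>inv\<close> says that the partner's label
  leads back. The group is otherwise arbitrary.\<close>

lemma matching_reply:
  assumes G: "rav_instance G S"
    and f: "\<And>g. g \<in> carrier G \<Longrightarrow> f g \<in> S \<union> m_inv G ` S"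
    and inv: "\<And>g. g \<in> carrier G \<Longrightarrow> f (g \<otimes>\<^bsub>G\<^esub> f g) = inv\<^bsub>G\<^esub> f g"
    and w: "rav_position G S w" "follows Player1 (\<lambda>w. f (word_value G w)) w"
    and "even (length w)" "\<not> revisits G w"
  shows "\<not> revisits G (w @ [f (word_value G w)])"
    and "legal_move G S w (f (word_value G w))"
proof -
  interpret group G using G by (simp add: rav_instance_def)
  have S: "S \<subseteq> carrier G" "\<one>\<^bsub>G\<^esub> \<notin> S" using G by (auto simp: rav_instance_def)
  define v where "v k = word_value G (take k w)" for k
  \<comment> \<open>The partner map: \<open>mm\<close> shows that it is an involution, and
    \<open>fne\<close> will exclude fixed points.\<close>
  define m where "m g = g \<otimes>\<^bsub>G\<^esub> f g" for g
  have v: "v k \<in> carrier G" for k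
    unfolding v_def by (rule word_value_closed[OF G rav_position_take[OF w(1)]])
  have fc: "f g \<in> carrier G" if "g \<in> carrier G" for g
    using f[OF that] S by auto
  have fne: "f g \<noteq> \<one>\<^bsub>G\<^esub>" if "g \<in> carrier G" for g
    using f[OF that] S by (auto dest: inv_eq_1_iff[THEN iffD1, rotated])
  have mm: "m (m g) = g" if "g \<in> carrier G" for g
    using that fc[OF that] inv[OF that] by (simp add: m_def m_assoc)
  have wv: "word_value G w = v (length w)" by (simp add: v_def)
  have step: "v (Suc k) = v k \<otimes>\<^bsub>G\<^esub> w ! k" if "k < length w" for k
    using that by (simp add: v_def take_Suc_conv_app_nth word_value_snoc)
  \<comment> \<open>Player 1 moves after every prefix of even length, so the visited elements pair
    up as \<open>v 0\<close>, \<open>v 1\<close>, then \<open>v 2\<close>, \<open>v 3\<close>, and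
    so on.\<close>
  have pair: "v (Suc k) = m (v k)" if "even k" "k < length w" for k
    using that w(2) by (simp add: step m_def follows_def to_move_def) (simp add: v_def)
  have new: "v (length w) \<noteq> v k" if "k < length w" for k
    using assms(7) that unfolding revisits_def wv by (auto simp: v_def)
  \<comment> \<open>A visited partner \<open>v k\<close> would make the current element the partner
    of \<open>v k\<close>, which was itself visited next to \<open>v k\<close>. The bound includes
    \<open>k = length w\<close> because the reply must also leave the current element.\<close>
  have fresh: "m (v (length w)) \<noteq> v k" if "k \<le> length w" for k
  proof
    assume eq: "m (v (length w)) = v k"
    then have vm: "v (length w) = m (v k)" using mm[OF v] by metis
    consider "k = length w" | "k < length w" "even k" | j where "k = Suc j" "even j" "j < length w"
    proof (cases "even k")
      case True
      then show ?thesis using that(1,2) \<open>k \<le> length w\<close> by (auto simp: le_less)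
    next
      case False
      then obtain j where "k = Suc j" "even j" by (cases k) auto
      then show ?thesis using \<open>k \<le> length w\<close> by (intro that(3)[of j]) auto
    qed
    then show False
    proof cases
      case 1
      then show False using eq fne[OF v] v fc[OF v] by (simp add: m_def)
    next
      case 2
      \<comment> \<open>Both \<open>k\<close> and \<open>length w\<close> are even, so the partner
        \<open>v (Suc k)\<close> lies strictly before the current element.\<close>
      then have "Suc k < length w" using assms(6) by (metis Suc_lessI even_Suc)
      then show False using new vm pair 2 by metis
    next
      case 3
      then show False using new vm pair mm[OF v] by metis
    qed
  qed
  show "\<not> revisits G (w @ [f (word_value G w)])"
    using fresh unfolding revisits_def
    by (auto simp: word_value_snoc v_def m_def less_Suc_eq_le)
  show "legal_move G S w (f (word_value G w))"
    unfolding legal_move_def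
  proof (intro conjI impI)
    show "f (word_value G w) \<in> S \<union> m_inv G ` S" using f v wv by simp
    \<comment> \<open>Cancelling the last letter would lead back to the element before it, which
      \<open>fresh\<close> excludes.\<close>
    assume "w \<noteq> []"
    then obtain k where k: "length w = Suc k" "last w = w ! k"
      by (cases w rule: rev_cases) auto
    have "w ! k \<in> carrier G"
      using w(1) k S by cases (auto simp: legal_move_def)
    moreover have "v (length w) = v k \<otimes>\<^bsub>G\<^esub> w ! k" using step[of k] k by simp
    ultimately have "v (length w) \<otimes>\<^bsub>G\<^esub> inv\<^bsub>G\<^esub> last w = v k"
      using v[of k] by (simp only: k(2)) (simp add: m_assoc)
    then show "f (word_value G w) \<noteq> inv\<^bsub>G\<^esub> last w"
      using fresh[of k] k(1) unfolding wv m_def by auto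
  qed
qed

text \<open>Player 1 loses neither way: the matching reply never revisits, and it is always legal,
  so Player 1 is never stuck.\<close>

lemma matching_has_winning_strategy:
  assumes G: "rav_instance G S"
    and f: "\<And>g. g \<in> carrier G \<Longrightarrow> f g \<in> S \<union> m_inv G ` S"
    and inv: "\<And>g. g \<in> carrier G \<Longrightarrow> f (g \<otimes>\<^bsub>G\<^esub> f g) = inv\<^bsub>G\<^esub> f g"
  shows "has_winning_strategy G S Player1"
proof -
  let ?\<sigma> = "\<lambda>w. f (word_value G w)"
  have reply: "\<not> revisits G (w @ [?\<sigma> w])" "legal_move G S w (?\<sigma> w)"
    if "rav_position G S w" "follows Player1 ?\<sigma> w" "even (length w)" "\<not> revisits G w" for w
    using matching_reply[of G S f] G f inv that by blast+
  \<comment> \<open>At even length Player 2 has moved last, so \<open>loser\<close> charges the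
    revisit to Player 2. At odd length the last letter would be a matching reply.\<close>
  have even: "even (length w)"
    if w: "rav_position G S w" "follows Player1 ?\<sigma> w" "revisits G w" for w
    using w(1)
  proof cases
    case start
    then show ?thesis by simp
  next
    case (move u s)
    have fu: "follows Player1 ?\<sigma> u"
      unfolding follows_def
    proof (intro allI impI)
      fix i assume "i < length u" "to_move (take i u) = Player1"
      then show "u ! i = ?\<sigma> (take i u)"
        using w(2) move(1) unfolding follows_def
        by (auto simp: nth_append dest!: spec[of _ i])
    qed
    show ?thesis
    proof (rule ccontr)
      assume "odd (length w)"
      then have e: "even (length u)" using move by simp
      then have "s = ?\<sigma> u"
        using w(2) move(1) unfolding follows_def
        by (auto simp: to_move_def dest!: spec[of _ "length u"])
      then show False
        using reply(1)[OF move(2) fu e] move w(3) by (auto simp: game_over_def)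
    qed
  qed
  have "winning_strategy G S Player1 ?\<sigma>"
    unfolding winning_strategy_def
  proof (intro allI impI)
    fix w assume "rav_position G S w \<and> follows Player1 ?\<sigma> w"
    then have w: "rav_position G S w" "follows Player1 ?\<sigma> w" by auto
    show "if game_over G S w then loser G w \<noteq> Player1
      else to_move w = Player1 \<longrightarrow> legal_move G S w (?\<sigma> w)"
      using even[OF w] reply(2)[OF w]
      by (auto simp: game_over_def loser_def to_move_def)
  qed
  with G show ?thesis unfolding has_winning_strategy_def by blast
qed

theorem theorem4p1:
  fixes n :: nat
  assumes "n \<ge> 2"
  shows "has_winning_strategy (Dic n) {dic_a n, dic_x n} Player1"
proof -
  have n: "n > 0" using assms by simp
  let ?cl = "pres_class (dic_rels n)"
  \<comment> \<open>The parity of the number of x-letters. By \<open>odd_x_cong\<close> it depends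
    only on the group element and tells the two cosets of the subgroup generated by a apart.\<close>
  define odd_x where "odd_x w = snd (foldl (dic_step n) (0, False) w)" for w
  have odd_x_snoc: "odd_x (w @ [(GenX, b)]) = (\<not> odd_x w)" for w b
    unfolding odd_x_def by (cases "foldl (dic_step n) (0, False) w") simp
  have odd_x_cong: "odd_x u = odd_x w" if "?cl u = ?cl w" for u w
    using dic_run_cong[OF n, of u w "(0, False)"] that n
    by (simp add: odd_x_def pres_class_eq_iff dic_states_def)
  \<comment> \<open>The Boolean is the sign of the exponent: the label is x on the powers of a and
    the inverse of x on the other coset.\<close>
  define f where "f g = ?cl [(GenX, \<exists>w. g = ?cl w \<and> \<not> odd_x w)]" for g
  have f: "f (?cl w) = ?cl [(GenX, \<not> odd_x w)]" for w
  proof -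
    have "(\<exists>u. ?cl w = ?cl u \<and> \<not> odd_x u) \<longleftrightarrow> \<not> odd_x w" using odd_x_cong by blast
    then show ?thesis by (simp add: f_def)
  qed
  have inv: "inv\<^bsub>Dic n\<^esub> ?cl [(GenX, b)] = ?cl [(GenX, \<not> b)]" for b
    by (simp add: Dic_def presented_inv_gen)
  show ?thesis
  proof (rule matching_has_winning_strategy[OF rav_instance_Dic[OF n], of f])
    fix g assume "g \<in> carrier (Dic n)"
    then obtain w where g: "g = ?cl w" by (auto simp: Dic_def presented_carrier)
    show "f g \<in> {dic_a n, dic_x n} \<union> m_inv (Dic n) ` {dic_a n, dic_x n}"
      using inv[of True] by (cases "odd_x w") (simp_all add: g f dic_x_def)
    \<comment> \<open>The appended x-letter flips the parity, so the partner's label has the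
      opposite sign.\<close>
    have "g \<otimes>\<^bsub>Dic n\<^esub> f g = ?cl (w @ [(GenX, \<not> odd_x w)])"
      unfolding g f by (simp add: Dic_def presented_mult)
    then show "f (g \<otimes>\<^bsub>Dic n\<^esub> f g) = inv\<^bsub>Dic n\<^esub> f g"
      using inv[of "\<not> odd_x w"] by (simp only: f odd_x_snoc g)
  qed
qed

end
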